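(* Let $n$ be a positive integer. If $n$ is odd, then $$\left\lfloor \left(\sum_{k=n}^{\infty} \frac{1}{J_{k}^{2}}\right)^{-1}\right\rfloor \geq J_{n-1}J_{n}.$$
   Context: The Jacobsthal numbers $(J_n)_{n\ge 0}$ are defined by $J_0=0$, $J_1=1$ and $J_{n+2}=J_{n+1}+2J_n$ for $n\ge 0$; the first terms are $0,1,1,3,5,11,21,43,85,\dots$. Here $\lfloor x\rfloor$ denotes the greatest integer not exceeding the real number $x$. *)

theory Defs
  imports Complex_Main
begin

fun jacobsthal :: "nat \<Rightarrow> nat" where
  "jacobsthal 0 = 0"
| "jacobsthal (Suc 0) = 1"
| "jacobsthal (Suc (Suc n)) = jacobsthal (Suc n) + 2 * jacobsthal n"

end

theory Submission
  imports Defs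
begin

text \<open>
  For \<open>m \<ge> 3\<close> the inequality \<open>1 / J\<^sub>m\<^sup>2 \<le> 1 / (J\<^sub>m\<^sub>-\<^sub>1 J\<^sub>m) - 1 / (J\<^sub>m J\<^sub>m\<^sub>+\<^sub>1)\<close> is, after clearing denominators,
  equivalent to \<open>2 J\<^sub>m\<^sub>-\<^sub>1\<^sup>2 \<le> J\<^sub>m\<^sup>2\<close>, which holds because \<open>J\<^sub>m\<close> and \<open>2 J\<^sub>m\<^sub>-\<^sub>1\<close> differ by at most 1.
  Telescoping bounds the series from above by \<open>1 / (J\<^sub>n\<^sub>-\<^sub>1 J\<^sub>n)\<close> for every \<open>n \<ge> 3\<close>.
\<close>

text \<open>The recurrence turns the defect \<open>jacobsthal (Suc n) - 2 * jacobsthal n\<close>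
  into its negative at the next index, so each bound yields the other one in the induction
  step.\<close>

lemma jacobsthal_Suc_near_double:
  "jacobsthal (Suc n) \<le> 2 * jacobsthal n + 1 \<and> 2 * jacobsthal n \<le> jacobsthal (Suc n) + 1"
  by (induction n) auto

lemma jacobsthal_pos: "n > 0 \<Longrightarrow> jacobsthal n > 0"
  by (induction n rule: jacobsthal.induct) auto

lemma jacobsthal_ge_3:
  assumes "n \<ge> 3"
  shows "jacobsthal n \<ge> 3"
  using assms
proof (induction n rule: dec_induct)
  case base
  show ?case by (simp add: eval_nat_numeral)
next
  case (step n)
  then show ?case
    using jacobsthal_Suc_near_double[of n] by linarith
qed

lemma jacobsthal_square_growth:
  assumes "n \<ge> 2"
  shows "2 * (jacobsthal n)\<^sup>2 \<le> (jacobsthal (Suc n))\<^sup>2"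
proof -
  define a b where "a = jacobsthal n" and "b = jacobsthal (Suc n)"
  have b: "b \<ge> 3" and ab: "2 * a \<le> b + 1"
    using jacobsthal_ge_3[of "Suc n"] jacobsthal_Suc_near_double[of n] assms
    by (auto simp: a_def b_def)
  have "(2 * a)\<^sup>2 \<le> (b + 1)\<^sup>2"
    using ab by (rule power_mono) simp
  \<comment> \<open>Squaring leaves \<open>4 * a\<^sup>2 \<le> b\<^sup>2 + 2 * b + 1\<close>; since
    \<open>b \<ge> 3\<close>, the tail \<open>2 * b + 1\<close> is at most \<open>3 * b\<close>,
    hence at most \<open>b\<^sup>2\<close>.\<close>
  moreover have "3 * b \<le> b * b"
    using b by simp
  ultimately have "2 * a\<^sup>2 \<le> b\<^sup>2"
    using b unfolding power2_eq_square by (simp only: algebra_simps)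
  then show ?thesis
    by (simp add: a_def b_def)
qed

lemma inverse_jacobsthal_square_le:
  assumes "n \<ge> 2"
  shows "1 / (real (jacobsthal (Suc n)))\<^sup>2
           \<le> 1 / (real (jacobsthal n) * real (jacobsthal (Suc n)))
             - 1 / (real (jacobsthal (Suc n)) * real (jacobsthal (Suc (Suc n))))"
proof -
  define a b where "a = real (jacobsthal n)" and "b = real (jacobsthal (Suc n))"
  have pos: "a > 0" "b > 0"
    using jacobsthal_pos[of n] jacobsthal_pos[of "Suc n"] assms by (auto simp: a_def b_def)
  have "real (2 * (jacobsthal n)\<^sup>2) \<le> real ((jacobsthal (Suc n))\<^sup>2)"
    using jacobsthal_square_growth[OF assms] by (rule of_nat_mono)
  then have "2 * a\<^sup>2 \<le> b\<^sup>2"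
    by (simp add: a_def b_def)
  then have "a * (b + 2 * a) \<le> b * (b + a)"
    by (simp add: power2_eq_square algebra_simps)
  then have "1 / b\<^sup>2 \<le> (b + a) / (a * b * (b + 2 * a))"
    using pos by (simp add: divide_simps power2_eq_square add_pos_pos mult.commute)
  also have "\<dots> = 1 / (a * b) - 1 / (b * (b + 2 * a))"
  proof -
    \<comment> \<open>Here \<open>c\<close> is the next Jacobsthal number. Kept opaque, it lets the
      numerator \<open>c - a\<close> split the fraction into the two telescoping terms.\<close>
    define c where "c = b + 2 * a"
    have "c > 0" "b + a = c - a"
      using pos by (simp_all add: c_def)
    then have "(b + a) / (a * b * c) = 1 / (a * b) - 1 / (b * c)"
      using pos by (simp only: diff_divide_distrib) simp
    then show ?thesis
      by (simp only: c_def)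
  qed
  finally show ?thesis
    by (simp add: a_def b_def)
qed

lemma sum_inverse_jacobsthal_square_le:
  assumes "n \<ge> 2"
  shows "(\<Sum>k<N. 1 / (real (jacobsthal (Suc n + k)))\<^sup>2)
           \<le> 1 / (real (jacobsthal n) * real (jacobsthal (Suc n)))"
proof -
  define t where "t k = 1 / (real (jacobsthal (n + k)) * real (jacobsthal (Suc (n + k))))" for k
  have "(\<Sum>k<N. 1 / (real (jacobsthal (Suc n + k)))\<^sup>2) \<le> (\<Sum>k<N. t k - t (Suc k))"
  proof (rule sum_mono)
    fix k
    show "1 / (real (jacobsthal (Suc n + k)))\<^sup>2 \<le> t k - t (Suc k)"
      using inverse_jacobsthal_square_le[of "n + k"] assms by (simp add: t_def)
  qed
  also have "\<dots> = t 0 - t N"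
    by (rule sum_lessThan_telescope')
  also have "\<dots> \<le> t 0"
    by (simp add: t_def)
  finally show ?thesis
    by (simp add: t_def)
qed

text \<open>The bounded partial sums start at index 3; shifting the index does not affect
  summability, and the term at index 0 is \<open>1 / 0 = 0\<close>.\<close>

lemma summable_inverse_jacobsthal_square:
  "summable (\<lambda>k. 1 / (real (jacobsthal (n + k)))\<^sup>2)"
proof -
  have "summable (\<lambda>k. 1 / (real (jacobsthal (k + 3)))\<^sup>2)"
    using sum_inverse_jacobsthal_square_le[of 2]
    by (intro summableI_nonneg_bounded) (simp_all add: add.commute)
  then have "summable (\<lambda>k. 1 / (real (jacobsthal k))\<^sup>2)"
    by (rule summable_iff_shift[THEN iffD1])
  then have "summable (\<lambda>k. 1 / (real (jacobsthal (k + n)))\<^sup>2)"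
    by (rule summable_iff_shift[THEN iffD2])
  then show ?thesis
    by (simp add: add.commute)
qed

theorem theorem2p2:
  fixes n :: nat
  assumes "n > 0" and "odd n"
  shows "\<lfloor>inverse (\<Sum>k. 1 / (real (jacobsthal (n + k)))\<^sup>2)\<rfloor>
           \<ge> int (jacobsthal (n - 1) * jacobsthal n)"
proof -
  define S where "S = (\<Sum>k. 1 / (real (jacobsthal (n + k)))\<^sup>2)"
  have S_pos: "S > 0"
    unfolding S_def
  proof (rule suminf_pos[OF summable_inverse_jacobsthal_square])
    fix k
    show "0 < 1 / (real (jacobsthal (n + k)))\<^sup>2"
      using jacobsthal_pos[of "n + k"] assms(1) by simp
  qed
  have "real (jacobsthal (n - 1) * jacobsthal n) \<le> inverse S"
  \<comment> \<open>For \<open>n = 1\<close> the product contains \<open>jacobsthal 0 = 0\<close>.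
    Otherwise oddness forces \<open>n \<ge> 3\<close>, excluding \<open>n = 2\<close>, where the
    first term alone is 1 and the bound fails.\<close>
  proof (cases "n = 1")
    case True
    then show ?thesis using S_pos by simp
  next
    case False
    then have "n - 1 \<ge> 2" and n: "Suc (n - 1) = n"
      using assms by presburger+
    then have "S \<le> 1 / real (jacobsthal (n - 1) * jacobsthal n)"
      using sum_inverse_jacobsthal_square_le[of "n - 1"]
      unfolding S_def n of_nat_mult
      by (intro suminf_le_const summable_inverse_jacobsthal_square)
    then show ?thesis
      using S_pos le_imp_inverse_le by fastforce
  qed
  then show ?thesis
    by (simp add: S_def le_floor_iff)
qed

end
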